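(* Let $A$ be a commutative ring with nonzero identity, let $M_1, M_2$ be $A$-modules, and let $f:M_{1}\rightarrow M_{2}$ be an $A$-module homomorphism. (i) If $P_{2}$ is a classical 1-absorbing prime submodule of $M_{2}$, then either $f^{-1}(P_{2})=M_{1}$ or $f^{-1}(P_{2})$ is a classical 1-absorbing prime submodule of $M_{1}$. (ii) If $f$ is surjective and $P_{1}$ is a classical 1-absorbing prime submodule of $M_{1}$ containing $\ker(f)$, then $f(P_{1})$ is a classical 1-absorbing prime submodule of $M_{2}$.
   Context: All rings are commutative with nonzero identity; the given modules are nonzero and unital. A proper submodule $P$ of an $A$-module $M$ is a classical 1-absorbing prime submodule if whenever $abcm\in P$ for nonunits $a,b,c\in A$ and $m\in M$, then $abm\in P$ or $cm\in P$. *)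

theory Defs
  imports "HOL-Algebra.Module" "HOL-Algebra.AbelCoset"
begin

definition module_homs ::
  "('a, 'r) ring_scheme \<Rightarrow> ('a, 'b, 'm) module_scheme \<Rightarrow> ('a, 'c, 'n) module_scheme \<Rightarrow> ('b \<Rightarrow> 'c) set"
  where "module_homs R M N =
    {f \<in> hom (add_monoid M) (add_monoid N).
       \<forall>a\<in>carrier R. \<forall>m\<in>carrier M. f (a \<odot>\<^bsub>M\<^esub> m) = a \<odot>\<^bsub>N\<^esub> f m}"

definition classical_1_absorbing_prime ::
  "('a, 'r) ring_scheme \<Rightarrow> ('a, 'b, 'm) module_scheme \<Rightarrow> 'b set \<Rightarrow> bool"
  where "classical_1_absorbing_prime R M P \<longleftrightarrow>
    submodule P R M \<and> P \<noteq> carrier M \<and>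
    (\<forall>a\<in>carrier R - Units R. \<forall>b\<in>carrier R - Units R. \<forall>c\<in>carrier R - Units R. \<forall>m\<in>carrier M.
       (a \<otimes>\<^bsub>R\<^esub> b \<otimes>\<^bsub>R\<^esub> c) \<odot>\<^bsub>M\<^esub> m \<in> P \<longrightarrow>
       (a \<otimes>\<^bsub>R\<^esub> b) \<odot>\<^bsub>M\<^esub> m \<in> P \<or> c \<odot>\<^bsub>M\<^esub> m \<in> P)"

end

theory Submission
  imports Defs
begin

text \<open>
  Everything rests on one equivalence. Suppose that \<open>P\<close> and \<open>Q\<close> are submodules of the source and
  the target of a module homomorphism \<open>f\<close> with \<open>x \<in> P \<longleftrightarrow> f x \<in> Q\<close> for every \<open>x\<close> in the source.
  Since \<open>f (r x) = r (f x)\<close>, each of the three memberships in the classical 1-absorbing condition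
  for \<open>P\<close> at \<open>m\<close> is the corresponding membership for \<open>Q\<close> at \<open>f m\<close>. The two conditions therefore
  differ only in the range of the module element: all of the source on one side, the image of
  \<open>f\<close> on the other.

  The preimage \<open>P = f\<^sup>-\<^sup>1(Q)\<close> satisfies the equivalence by construction, which gives the first
  part, whose first alternative is exactly the failure of properness. For \<open>Q = f(P)\<close> the equivalence says
  that \<open>P\<close> is saturated (\<open>image_saturated\<close>), and this is where \<open>ker f \<subseteq> P\<close> enters: elements with equal images differ by
  an element of the kernel. Surjectivity then makes the range of the module element all of the
  target, and saturation carries properness over.
\<close>

locale module_homomorphism =
  source: module A M + target: module A N
  for A :: "('a, 'r) ring_scheme"
    and M :: "('a, 'b, 'm) module_scheme"
    and N :: "('a, 'c, 'n) module_scheme" +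
  fixes f :: "'b \<Rightarrow> 'c"
  assumes homomorphism: "f \<in> module_homs A M N"
begin

sublocale additive: group_hom "add_monoid M" "add_monoid N" f
  using homomorphism source.M.a_group target.M.a_group
  by (simp add: group_hom_def group_hom_axioms_def module_homs_def)

lemma map_closed: "x \<in> carrier M \<Longrightarrow> f x \<in> carrier N"
  using additive.hom_closed by simp

lemma map_zero: "f \<zero>\<^bsub>M\<^esub> = \<zero>\<^bsub>N\<^esub>"
  using additive.hom_one by simp

lemma map_add: "x \<in> carrier M \<Longrightarrow> y \<in> carrier M \<Longrightarrow> f (x \<oplus>\<^bsub>M\<^esub> y) = f x \<oplus>\<^bsub>N\<^esub> f y"
  using additive.hom_mult by simp

lemma map_neg: "x \<in> carrier M \<Longrightarrow> f (\<ominus>\<^bsub>M\<^esub> x) = \<ominus>\<^bsub>N\<^esub> f x"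
  using additive.hom_inv by (simp add: a_inv_def)

lemma map_smult: "r \<in> carrier A \<Longrightarrow> x \<in> carrier M \<Longrightarrow> f (r \<odot>\<^bsub>M\<^esub> x) = r \<odot>\<^bsub>N\<^esub> f x"
  using homomorphism by (simp add: module_homs_def)

lemma preimage_submodule:
  assumes "submodule Q A N"
  shows "submodule (f -` Q \<inter> carrier M) A M"
proof -
  have zero: "\<zero>\<^bsub>N\<^esub> \<in> Q"
    using subgroup.one_closed[OF submodule.axioms(1)[OF assms]] by simp
  show ?thesis
    by (rule source.submoduleI)
      (use zero target.submoduleE[OF assms] in
        \<open>auto simp: map_zero map_neg map_add map_smult\<close>)
qed

lemma image_submodule:
  assumes "submodule P A M"
  shows "submodule (f ` P) A N"
proof (intro submodule.intro submodule_axioms.intro)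
  show "subgroup (f ` P) (add_monoid N)"
    using additive.subgroup_img_is_subgroup submodule.axioms(1)[OF assms] by blast
next
  fix r y assume "r \<in> carrier A" "y \<in> f ` P"
  then show "r \<odot>\<^bsub>N\<^esub> y \<in> f ` P"
    using source.submoduleE(1,4)[OF assms] by (auto simp flip: map_smult)
qed

text \<open>
  If \<open>f x = f p\<close> with \<open>p \<in> P\<close>, then \<open>x - p\<close> lies in the kernel, hence in \<open>P\<close>, and so does
  \<open>x = (x - p) + p\<close>.
\<close>

lemma image_saturated:
  assumes "submodule P A M" and kernel: "a_kernel M N f \<subseteq> P" and x: "x \<in> carrier M"
  shows "f x \<in> f ` P \<longleftrightarrow> x \<in> P"
proof
  assume "f x \<in> f ` P"
  then obtain p where p: "p \<in> P" "f x = f p" by blast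
  have p_carrier: "p \<in> carrier M"
    using source.submoduleE(1)[OF assms(1)] p(1) by blast
  have "f (x \<oplus>\<^bsub>M\<^esub> \<ominus>\<^bsub>M\<^esub> p) = \<zero>\<^bsub>N\<^esub>"
    using x p_carrier p(2) by (simp add: map_add map_neg map_closed target.M.r_neg)
  then have "x \<oplus>\<^bsub>M\<^esub> \<ominus>\<^bsub>M\<^esub> p \<in> P"
    using kernel x p_carrier by (auto simp: a_kernel_def')
  then have "(x \<oplus>\<^bsub>M\<^esub> \<ominus>\<^bsub>M\<^esub> p) \<oplus>\<^bsub>M\<^esub> p \<in> P"
    using source.submoduleE(5)[OF assms(1)] p(1) by blast
  then show "x \<in> P"
    using x p_carrier by (simp add: source.M.a_assoc source.M.l_neg)
qed blast

theorem preimage_classical_1_absorbing_prime: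
  assumes Q: "classical_1_absorbing_prime A N Q"
    and proper: "f -` Q \<inter> carrier M \<noteq> carrier M"
  shows "classical_1_absorbing_prime A M (f -` Q \<inter> carrier M)"
proof -
  have "(a \<otimes>\<^bsub>A\<^esub> b) \<odot>\<^bsub>M\<^esub> m \<in> f -` Q \<inter> carrier M \<or> c \<odot>\<^bsub>M\<^esub> m \<in> f -` Q \<inter> carrier M"
    if nonunits: "a \<in> carrier A - Units A" "b \<in> carrier A - Units A" "c \<in> carrier A - Units A"
      and m: "m \<in> carrier M"
      and absorb: "(a \<otimes>\<^bsub>A\<^esub> b \<otimes>\<^bsub>A\<^esub> c) \<odot>\<^bsub>M\<^esub> m \<in> f -` Q \<inter> carrier M"
    for a b c m
  proof -
    have "(a \<otimes>\<^bsub>A\<^esub> b \<otimes>\<^bsub>A\<^esub> c) \<odot>\<^bsub>N\<^esub> f m \<in> Q"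
      using absorb nonunits m by (simp add: map_smult)
    then have "(a \<otimes>\<^bsub>A\<^esub> b) \<odot>\<^bsub>N\<^esub> f m \<in> Q \<or> c \<odot>\<^bsub>N\<^esub> f m \<in> Q"
      using Q nonunits map_closed[OF m] unfolding classical_1_absorbing_prime_def by blast
    then show ?thesis
      using nonunits m by (simp add: map_smult)
  qed
  then show ?thesis
    using Q proper preimage_submodule unfolding classical_1_absorbing_prime_def by blast
qed

theorem image_classical_1_absorbing_prime:
  assumes surjective: "f ` carrier M = carrier N"
    and P: "classical_1_absorbing_prime A M P"
    and kernel: "a_kernel M N f \<subseteq> P"
  shows "classical_1_absorbing_prime A N (f ` P)"
proof -
  have submodule: "submodule P A M" and "P \<noteq> carrier M"
    using P by (simp_all add: classical_1_absorbing_prime_def)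
  note saturated = image_saturated[OF submodule kernel]
  have proper: "f ` P \<noteq> carrier N"
  proof
    assume "f ` P = carrier N"
    then have "carrier M \<subseteq> P"
      using saturated map_closed by blast
    then show False
      using source.submoduleE(1)[OF submodule] \<open>P \<noteq> carrier M\<close> by blast
  qed
  have "(a \<otimes>\<^bsub>A\<^esub> b) \<odot>\<^bsub>N\<^esub> n \<in> f ` P \<or> c \<odot>\<^bsub>N\<^esub> n \<in> f ` P"
    if nonunits: "a \<in> carrier A - Units A" "b \<in> carrier A - Units A" "c \<in> carrier A - Units A"
      and n: "n \<in> carrier N"
      and absorb: "(a \<otimes>\<^bsub>A\<^esub> b \<otimes>\<^bsub>A\<^esub> c) \<odot>\<^bsub>N\<^esub> n \<in> f ` P"
    for a b c n
  proof -
    obtain m where m: "m \<in> carrier M" "n = f m"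
      using n surjective by blast
    have transfer: "r \<odot>\<^bsub>N\<^esub> n \<in> f ` P \<longleftrightarrow> r \<odot>\<^bsub>M\<^esub> m \<in> P" if "r \<in> carrier A" for r
      using saturated[of "r \<odot>\<^bsub>M\<^esub> m"] that m by (simp add: map_smult)
    have "(a \<otimes>\<^bsub>A\<^esub> b \<otimes>\<^bsub>A\<^esub> c) \<odot>\<^bsub>M\<^esub> m \<in> P"
      using absorb nonunits transfer by simp
    then have "(a \<otimes>\<^bsub>A\<^esub> b) \<odot>\<^bsub>M\<^esub> m \<in> P \<or> c \<odot>\<^bsub>M\<^esub> m \<in> P"
      using P nonunits m(1) unfolding classical_1_absorbing_prime_def by blast
    then show ?thesis
      using nonunits transfer by simp
  qed
  then show ?thesis
    using image_submodule[OF submodule] proper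
    unfolding classical_1_absorbing_prime_def by blast
qed

end

theorem theorem1:
  fixes A :: "('a, 'r) ring_scheme"
    and M1 :: "('a, 'b, 'm) module_scheme"
    and M2 :: "('a, 'c, 'n) module_scheme"
    and f :: "'b \<Rightarrow> 'c"
  assumes "cring A" and "\<one>\<^bsub>A\<^esub> \<noteq> \<zero>\<^bsub>A\<^esub>"
    and "module A M1" and "carrier M1 \<noteq> {\<zero>\<^bsub>M1\<^esub>}"
    and "module A M2" and "carrier M2 \<noteq> {\<zero>\<^bsub>M2\<^esub>}"
    and "f \<in> module_homs A M1 M2"
  shows "(\<forall>P2. classical_1_absorbing_prime A M2 P2 \<longrightarrow>
            f -` P2 \<inter> carrier M1 = carrier M1 \<or>
            classical_1_absorbing_prime A M1 (f -` P2 \<inter> carrier M1)) \<and>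
         (f ` carrier M1 = carrier M2 \<longrightarrow>
            (\<forall>P1. classical_1_absorbing_prime A M1 P1 \<and> a_kernel M1 M2 f \<subseteq> P1 \<longrightarrow>
               classical_1_absorbing_prime A M2 (f ` P1)))"
proof -
  interpret module_homomorphism A M1 M2 f
    using assms by (simp add: module_homomorphism_def module_homomorphism_axioms_def)
  show ?thesis
    using preimage_classical_1_absorbing_prime image_classical_1_absorbing_prime by blast
qed

end
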